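(* Let $n\ge 2$, $p=n(n+1)/2$, $T_0=4\ln(p)$, let $\mathcal S\subset\mathbb Z_+^n$ be a finite nonempty set of configurations with a fixed tie-breaking order, and let $D=\max_{(u,v)\in\mathcal S^2}\|u-v\|_\infty$. Consider an expert projective cone scheduler with parameter array $b$, and let $(y_1,s_1),(y_2,s_2),\dots$ be the observed normalized backlogs and expert decisions, $s_t=\mu(y_t;b)$. Run the unknown-horizon multiplicative-weights algorithm (Algorithm 2 in the context) on these observations, and let $\ell_t$ be the resulting losses. Write $\lg(\cdot)=\lceil\log_2(\cdot)\rceil$. Then for every integer $T\ge T_0$, $$0\le\frac1T\sum_{t=1}^T\ell_t\le 2\sqrt2\,D\,\lg\!\left(\frac{2T}{T_0}\right)\sqrt{\frac{\ln(p)}{T}}.$$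
   Context: Notation: $\mathbb Z_+=\{0,1,2,\dots\}$, $[n]=\{1,\dots,n\}$. "Array" means a real array indexed by pairs $(i,j)\in[n]^2$ with $i\le j$ (so it has $p=n(n+1)/2$ entries). $\sigma(i,j)=1$ if $i=j$ and $-1$ if $i\ne j$. For $u,y\in\mathbb R^n$ and $i\le j$ put $q_{ij}(u,y)=u(i)y(i)$ if $i=j$ and $q_{ij}(u,y)=u(i)y(j)+u(j)y(i)$ if $i<j$. Queueing model: backlogs $x_t\in\mathbb Z_+^n$ satisfy $x_{t+1}=x_t-d_t+a_t$ with $x_0\in\mathbb Z_+^n$ arbitrary, $d_t=\min\{s_t,x_t\}$ componentwise, where $s_t\in\mathcal S$ is the expert's configuration, and arrivals $a_t\in\mathbb Z_+^n$ that are arbitrary (they may depend arbitrarily on past backlogs, arrivals and configurations). The normalized backlog is $y_t=x_t/\|x_t\|_1$ if $\|x_t\|_1\neq0$ and $y_t=0$ otherwise. Scheduler: for an array $\beta$ and $y\in\mathbb R_+^n$, $$\mu(y;\beta)=\arg\max_{s\in\mathcal S}\sum_{i\le j}\sigma(i,j)\,\beta(i,j)\,q_{ij}(s,y),$$ with ties broken by the fixed ordering of $\mathcal S$. The expert is given by a symmetric positive-definite $B\in\mathbb R^{n\times n}$ with non-positive off-diagonal entries, and chooses $s_t=\arg\max_{s\in\mathcal S}\langle s,Bx_t\rangle$ (same tie-breaking). Its array $b$ is $b(i,i)=cB(i,i)$ and $b(i,j)=-cB(i,j)$ for $i<j$, with $c>0$ chosen so that $\sum_{i\le j}b(i,j)=1$;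 thus $b\ge0$ and $s_t=\mu(x_t;b)=\mu(y_t;b)$. Algorithm 2: let $T_{-1}=0$ and $T_k=2^k\cdot4\ln(p)$ for $k\ge0$. The learning rate at time $t\ge1$ is $\eta_t=\sqrt{\ln(p)/T_k}$ if $T_k<t\le T_{k+1}$ with $k\ge0$, and $\eta_t=\sqrt{\ln(p)/T_0}=1/2$ if $0<t\le T_0$ (i.e. in each epoch $(T_k,T_{k+1}]$ the horizon parameter is the epoch length $T_{k+1}-T_k$). Set $w_1(i,j)=1$ for all $i\le j$; the weights are never re-initialized. For $t=1,2,\dots$: set $\hat b_t=w_t/\sum_{i\le j}w_t(i,j)$, $\hat s_t=\mu(y_t;\hat b_t)$, $\delta_t=\hat s_t-s_t$. If $\delta_t=0$ let $m_t=0$; otherwise let $z_t=\delta_t/\|\delta_t\|_\infty$ and $m_t(i,j)=\sigma(i,j)\,q_{ij}(z_t,y_t)$ for $i\le j$. Update $w_{t+1}(i,j)=w_t(i,j)(1-\eta_t\, m_t(i,j))$. Loss: $\ell_t=\sum_{i\le j}\sigma(i,j)\,(\hat b_t(i,j)-b(i,j))\,q_{ij}(\delta_t,y_t)$. *)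

theory Defs
  imports "HOL-Analysis.Analysis"
begin

type_synonym 'n config = "(nat, 'n) vec"
type_synonym 'n rvec = "(real, 'n) vec"
type_synonym 'n rmatrix = "((real, 'n) vec, 'n) vec"

definition vreal :: "'n::finite config \<Rightarrow> 'n rvec" where
  "vreal u = (\<chi> i. real (u $ i))"

definition l1norm :: "'n::finite rvec \<Rightarrow> real" where
  "l1norm u = (\<Sum>i\<in>UNIV. \<bar>u $ i\<bar>)"

definition normalized_backlog :: "'n::finite config \<Rightarrow> 'n rvec" where
  "normalized_backlog x =
     (if l1norm (vreal x) \<noteq> 0 then (1 / l1norm (vreal x)) *\<^sub>R vreal x else 0)"

text \<open>
  An array is a function \<open>'n \<Rightarrow> 'n \<Rightarrow> real\<close>; only its values at pairs in \<open>array_index\<close> are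
  ever used. Entries below the diagonal are irrelevant.
\<close>

definition array_index :: "('n::linorder \<times> 'n) set" where
  "array_index = {(i, j). i \<le> j}"

definition sigma :: "'n \<Rightarrow> 'n \<Rightarrow> real" where
  "sigma i j = (if i = j then 1 else -1)"

definition q :: "'n::finite \<Rightarrow> 'n \<Rightarrow> 'n rvec \<Rightarrow> 'n rvec \<Rightarrow> real" where
  "q i j u y = (if i = j then u $ i * y $ i else u $ i * y $ j + u $ j * y $ i)"

definition array_form ::
  "('n::{finite,linorder} \<Rightarrow> 'n \<Rightarrow> real) \<Rightarrow> 'n rvec \<Rightarrow> 'n rvec \<Rightarrow> real" where
  "array_form \<beta> u y =
     (\<Sum>(i, j)\<in>array_index. sigma i j * \<beta> i j * q i j u y)"

text \<open>
  Ties are broken by a linear order \<open>r\<close> on \<open>S\<close>: among all maximizers of \<open>f\<close>, the \<open>r\<close>-least one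
  is selected. It exists and is unique when \<open>S\<close> is finite and nonempty.
\<close>

definition first_argmax :: "'a set \<Rightarrow> 'a rel \<Rightarrow> ('a \<Rightarrow> real) \<Rightarrow> 'a" where
  "first_argmax S r f =
     (THE u. is_arg_max f (\<lambda>v. v \<in> S) u \<and> (\<forall>v. is_arg_max f (\<lambda>v. v \<in> S) v \<longrightarrow> (u, v) \<in> r))"

definition scheduler ::
  "'n::{finite,linorder} config set \<Rightarrow> 'n config rel \<Rightarrow> ('n \<Rightarrow> 'n \<Rightarrow> real) \<Rightarrow> 'n rvec \<Rightarrow> 'n config"
  where
  "scheduler S r \<beta> y = first_argmax S r (\<lambda>u. array_form \<beta> (vreal u) y)"

definition expert_config ::
  "'n::finite config set \<Rightarrow> 'n config rel \<Rightarrow> 'n rmatrix \<Rightarrow> 'n config \<Rightarrow> 'n config" where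
  "expert_config S r B x = first_argmax S r (\<lambda>u. vreal u \<bullet> (B *v vreal x))"

definition expert_array :: "real \<Rightarrow> 'n::finite rmatrix \<Rightarrow> 'n \<Rightarrow> 'n \<Rightarrow> real" where
  "expert_array c B i j = (if i = j then c * B $ i $ i else - c * B $ i $ j)"

definition positive_definite :: "'n::finite rmatrix \<Rightarrow> bool" where
  "positive_definite B \<longleftrightarrow> (\<forall>v. v \<noteq> 0 \<longrightarrow> v \<bullet> (B *v v) > 0)"

definition config_diameter :: "'n::finite config set \<Rightarrow> real" where
  "config_diameter S = Max ((\<lambda>(u, v). infnorm (vreal u - vreal v)) ` (S \<times> S))"

text \<open>
  \<open>epoch_bound p k\<close> is the end of an epoch; the half-open intervals between consecutive values
  partition the times after \<open>epoch_bound p 0\<close>, so the \<open>THE\<close> in \<open>learning_rate\<close> is well defined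
  for \<open>p \<ge> 2\<close>.
\<close>

definition epoch_bound :: "nat \<Rightarrow> nat \<Rightarrow> real" where
  "epoch_bound p k = 2 ^ k * (4 * ln (real p))"

definition learning_rate :: "nat \<Rightarrow> nat \<Rightarrow> real" where
  "learning_rate p t =
     (if real t \<le> epoch_bound p 0 then sqrt (ln (real p) / epoch_bound p 0)
      else sqrt (ln (real p) /
             epoch_bound p (THE k. epoch_bound p k < real t \<and> real t \<le> epoch_bound p (Suc k))))"

definition normalize_array :: "('n::{finite,linorder} \<Rightarrow> 'n \<Rightarrow> real) \<Rightarrow> 'n \<Rightarrow> 'n \<Rightarrow> real" where
  "normalize_array w i j =
     w i j / (\<Sum>(k, l)\<in>array_index. w k l)"

definition mw_cost :: "'n::finite rvec \<Rightarrow> 'n rvec \<Rightarrow> 'n \<Rightarrow> 'n \<Rightarrow> real" where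
  "mw_cost \<delta> y i j =
     (if \<delta> = 0 then 0 else sigma i j * q i j ((1 / infnorm \<delta>) *\<^sub>R \<delta>) y)"

text \<open>
  The observations are \<open>y 1, y 2, \<dots>\<close> and \<open>s 1, s 2, \<dots>\<close>; index 0 of \<open>y\<close>, \<open>s\<close> and of the weights
  is not used by the algorithm.
\<close>

primrec mw_weights ::
  "'n::{finite,linorder} config set \<Rightarrow> 'n config rel \<Rightarrow> nat \<Rightarrow>
   (nat \<Rightarrow> 'n rvec) \<Rightarrow> (nat \<Rightarrow> 'n config) \<Rightarrow> nat \<Rightarrow> 'n \<Rightarrow> 'n \<Rightarrow> real"
  where
  "mw_weights S r p y s 0 = (\<lambda>i j. 1)"
| "mw_weights S r p y s (Suc t) =
     (if t = 0 then (\<lambda>i j. 1)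
      else let w = mw_weights S r p y s t;
               \<delta> = vreal (scheduler S r (normalize_array w) (y t)) - vreal (s t)
           in (\<lambda>i j. w i j * (1 - learning_rate p t * mw_cost \<delta> (y t) i j)))"

definition mw_estimate ::
  "'n::{finite,linorder} config set \<Rightarrow> 'n config rel \<Rightarrow> nat \<Rightarrow>
   (nat \<Rightarrow> 'n rvec) \<Rightarrow> (nat \<Rightarrow> 'n config) \<Rightarrow> nat \<Rightarrow> 'n \<Rightarrow> 'n \<Rightarrow> real"
  where
  "mw_estimate S r p y s t = normalize_array (mw_weights S r p y s t)"

definition mw_loss ::
  "'n::{finite,linorder} config set \<Rightarrow> 'n config rel \<Rightarrow> nat \<Rightarrow> ('n \<Rightarrow> 'n \<Rightarrow> real) \<Rightarrow>
   (nat \<Rightarrow> 'n rvec) \<Rightarrow> (nat \<Rightarrow> 'n config) \<Rightarrow> nat \<Rightarrow> real"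
  where
  "mw_loss S r p b y s t =
     (let bhat = mw_estimate S r p y s t;
          \<delta> = vreal (scheduler S r bhat (y t)) - vreal (s t)
      in \<Sum>(i, j)\<in>array_index. sigma i j * (bhat i j - b i j) * q i j \<delta> (y t))"

end

theory Submission
  imports Defs
begin

text \<open>
  Both the expert and the learner maximize over the same set, so every loss is nonnegative. The
  potential argument for multiplicative weights works with time-dependent rates and bounds
  \<open>\<Sum>t\<le>T. \<eta> t * loss t\<close> by \<open>ln p + \<Sum>t\<le>T. (\<eta> t)\<^sup>2\<close>. As the losses are nonnegative and the rates
  decrease, the left-hand side is at least \<open>\<eta> T\<close> times the total loss; hence the weights need not
  be reset between epochs. Each epoch contributes about \<open>ln p\<close> to the sum of the squared rates.
\<close>

section \<open>Multiplicative weights with varying rates\<close>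

text \<open>For \<open>x \<ge> 0\<close> the gap between the two sides vanishes at 0 and has
  derivative \<open>u * (1 - 2 * u) / (1 - u)\<close>, which is nonnegative exactly up to
  \<open>u = 1/2\<close> on \<open>[0, 1)\<close>. Negative \<open>x\<close> reduces to the
  quadratic lower bound for \<open>ln (1 + y)\<close> with \<open>y = -x\<close>.\<close>

lemma ln_one_minus_lower_bound:
  fixes x :: real
  assumes "\<bar>x\<bar> \<le> 1/2"
  shows "- x - x\<^sup>2 \<le> ln (1 - x)"
proof (cases "x \<ge> 0")
  case True
  let ?f = "\<lambda>x::real. ln (1 - x) + x + x\<^sup>2"
  have "?f 0 \<le> ?f x"
  proof (rule DERIV_nonneg_imp_nondecreasing[OF True])
    fix u assume u: "0 \<le> u" "u \<le> x"
    then have u': "u \<le> 1/2" using assms by simp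
    have "(?f has_real_derivative u * (1 - 2 * u) / (1 - u)) (at u)"
      using u' by (auto intro!: derivative_eq_intros simp: field_simps)
    moreover have "0 \<le> u * (1 - 2 * u) / (1 - u)" using u u' by simp
    ultimately show "\<exists>y. (?f has_real_derivative y) (at u) \<and> 0 \<le> y" by blast
  qed
  then show ?thesis by simp
next
  case False
  then show ?thesis using assms ln_one_plus_pos_lower_bound[of "-x"] by auto
qed

text \<open>The potential is the \<open>\<beta>\<close>-average of the logarithms of the normalized
  weights, that is, a negative cross-entropy. It starts at minus the logarithm of
  \<open>card I\<close>, stays at most 0, and in each round gains at least the rate times the regret
  minus the squared rate.\<close>

lemma multiplicative_weights_regret:
  fixes w m :: "nat \<Rightarrow> 'i \<Rightarrow> real" and \<eta> :: "nat \<Rightarrow> real" and \<beta> :: "'i \<Rightarrow> real"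
  assumes I: "finite I"
    and w1: "\<And>i. i \<in> I \<Longrightarrow> w 1 i = 1"
    and wS: "\<And>t i. t \<ge> 1 \<Longrightarrow> i \<in> I \<Longrightarrow> w (Suc t) i = w t i * (1 - \<eta> t * m t i)"
    and m: "\<And>t i. i \<in> I \<Longrightarrow> \<bar>m t i\<bar> \<le> 1"
    and eta: "\<And>t. 0 \<le> \<eta> t" "\<And>t. \<eta> t \<le> 1/2"
    and \<beta>: "\<And>i. i \<in> I \<Longrightarrow> 0 \<le> \<beta> i" "sum \<beta> I = 1"
  shows "(\<Sum>t=1..T. \<eta> t * (\<Sum>i\<in>I. (w t i / sum (w t) I - \<beta> i) * m t i))
           \<le> ln (real (card I)) + (\<Sum>t=1..T. (\<eta> t)\<^sup>2)"
proof -
  have ne: "I \<noteq> {}" using \<beta>(2) by auto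
  have em: "\<bar>\<eta> t * m t i\<bar> \<le> 1/2" "(\<eta> t * m t i)\<^sup>2 \<le> (\<eta> t)\<^sup>2" if "i \<in> I" for t i
  proof -
    have *: "\<bar>\<eta> t * m t i\<bar> \<le> \<eta> t"
      using mult_left_mono[OF m[OF that] eta(1), of t t] eta(1)[of t] by (simp add: abs_mult)
    then show "\<bar>\<eta> t * m t i\<bar> \<le> 1/2" using eta(2)[of t] by simp
    show "(\<eta> t * m t i)\<^sup>2 \<le> (\<eta> t)\<^sup>2" using * eta(1)[of t] by (simp add: abs_le_square_iff[symmetric])
  qed
  \<comment> \<open>The shift to \<open>Suc t\<close> is needed because the recursion starts at time
    1 and leaves \<open>w 0\<close> unconstrained. \<open>H\<close> below is shifted in the same
    way.\<close>
  have pos: "0 < w (Suc t) i" if "i \<in> I" for t i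
  proof (induction t)
    case 0 then show ?case using w1 that by simp
  next
    case (Suc t)
    have "0 < 1 - \<eta> (Suc t) * m (Suc t) i" using em(1)[OF that, of "Suc t"] by auto
    then show ?case using Suc wS[of "Suc t" i] that by simp
  qed
  have Wpos: "0 < sum (w (Suc t)) I" for t
    using pos I ne by (intro sum_pos) auto
  define H where "H t = (\<Sum>i\<in>I. \<beta> i * ln (w (Suc t) i)) - ln (sum (w (Suc t)) I)" for t
  have H_le: "H t \<le> 0" for t
  proof -
    have "(\<Sum>i\<in>I. \<beta> i * ln (w (Suc t) i)) \<le> (\<Sum>i\<in>I. \<beta> i * ln (sum (w (Suc t)) I))"
    proof (intro sum_mono mult_left_mono)
      fix i assume i: "i \<in> I"
      have "w (Suc t) i \<le> sum (w (Suc t)) I"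
        using i I pos by (intro member_le_sum) (auto intro: less_imp_le)
      then show "ln (w (Suc t) i) \<le> ln (sum (w (Suc t)) I)" 
        using pos[OF i, of t] pos Wpos[of t] by (subst ln_le_cancel_iff) auto
    qed (use \<beta> in auto)
    also have "\<dots> = ln (sum (w (Suc t)) I)" using \<beta>(2) by (simp flip: sum_distrib_right)
    finally show ?thesis unfolding H_def by simp
  qed
  have H_step: "H t + \<eta> (Suc t) * (\<Sum>i\<in>I. (w (Suc t) i / sum (w (Suc t)) I - \<beta> i) * m (Suc t) i)
      - (\<eta> (Suc t))\<^sup>2 \<le> H (Suc t)" for t
  proof -
    let ?u = "Suc t" and ?W = "sum (w (Suc t)) I"
    let ?g = "\<Sum>i\<in>I. w ?u i / ?W * m ?u i"
    have W: "sum (w (Suc ?u)) I = ?W * (1 - \<eta> ?u * ?g)"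
    proof -
      have "?W * ?g = (\<Sum>i\<in>I. w ?u i * m ?u i)"
        using Wpos[of t] by (simp add: sum_distrib_left)
      moreover have "sum (w (Suc ?u)) I = ?W - \<eta> ?u * (\<Sum>i\<in>I. w ?u i * m ?u i)"
        by (simp add: wS sum_subtractf right_diff_distrib sum_distrib_left mult_ac)
      ultimately show ?thesis by (simp only: right_diff_distrib mult.left_commute mult_1_right)
    qed
    \<comment> \<open>The shrinking factor of the total weight is positive because it is the
      quotient of two positive totals. Then \<open>ln z \<le> z - 1\<close> bounds the new logarithm
      of the total from above.\<close>
    have "0 < 1 - \<eta> ?u * ?g" using Wpos[of ?u] Wpos[of t] unfolding W by (simp add: zero_less_mult_iff)
    then have lnW: "ln (sum (w (Suc ?u)) I) \<le> ln ?W - \<eta> ?u * ?g"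
      using ln_le_minus_one[of "1 - \<eta> ?u * ?g"] Wpos[of t] unfolding W by (simp add: ln_mult)
    \<comment> \<open>The individual logarithms need the opposite direction, and the second-order
      bound costs one squared rate. As \<open>\<beta>\<close> sums to 1, averaging leaves that cost
      unchanged.\<close>
    have "(\<Sum>i\<in>I. \<beta> i * (ln (w ?u i) - \<eta> ?u * m ?u i - (\<eta> ?u)\<^sup>2)) \<le> (\<Sum>i\<in>I. \<beta> i * ln (w (Suc ?u) i))"
    proof (intro sum_mono mult_left_mono)
      fix i assume i: "i \<in> I"
      have "0 < 1 - \<eta> ?u * m ?u i" using em(1)[OF i, of ?u] by auto
      then have "ln (w (Suc ?u) i) = ln (w ?u i) + ln (1 - \<eta> ?u * m ?u i)"
        using wS[of ?u i] i pos[OF i, of t] by (simp add: ln_mult)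
      then show "ln (w ?u i) - \<eta> ?u * m ?u i - (\<eta> ?u)\<^sup>2 \<le> ln (w (Suc ?u) i)"
        using ln_one_minus_lower_bound[OF em(1)[OF i, of ?u]] em(2)[OF i, of ?u] by simp
    qed (use \<beta> in auto)
    also have "(\<Sum>i\<in>I. \<beta> i * (ln (w ?u i) - \<eta> ?u * m ?u i - (\<eta> ?u)\<^sup>2))
        = (\<Sum>i\<in>I. \<beta> i * ln (w ?u i)) - \<eta> ?u * (\<Sum>i\<in>I. \<beta> i * m ?u i) - (\<eta> ?u)\<^sup>2"
      using \<beta>(2) by (simp add: right_diff_distrib sum_subtractf sum_distrib_left mult_ac flip: sum_distrib_right)
    finally show ?thesis
      using lnW unfolding H_def by (simp add: left_diff_distrib sum_subtractf right_diff_distrib)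
  qed
  have "H 0 + (\<Sum>t=1..T. \<eta> t * (\<Sum>i\<in>I. (w t i / sum (w t) I - \<beta> i) * m t i))
      - (\<Sum>t=1..T. (\<eta> t)\<^sup>2) \<le> H T"
  proof (induction T)
    case 0 then show ?case by simp
  next
    case (Suc T) then show ?case using H_step[of T] by simp
  qed
  moreover have "H 0 = - ln (real (card I))" using w1 by (simp add: H_def)
  ultimately show ?thesis using H_le[of T] by simp
qed

section \<open>Learning rates\<close>

lemma epoch_bound_Suc: "epoch_bound p (Suc k) = 2 * epoch_bound p k"
  by (simp add: epoch_bound_def)

lemma epoch_bound_pos: "p \<ge> 2 \<Longrightarrow> 0 < epoch_bound p k"
  by (simp add: epoch_bound_def)

lemma epoch_bound_le_iff: "p \<ge> 2 \<Longrightarrow> epoch_bound p j \<le> epoch_bound p k \<longleftrightarrow> j \<le> k"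
  by (simp add: epoch_bound_def)

text \<open>The bounds double, so some bound is at least \<open>t\<close>. If the least such index
  is not 0, its predecessor is the epoch of \<open>t\<close>.\<close>

lemma epoch_cases:
  assumes "p \<ge> 2"
  obtains "real t \<le> epoch_bound p 0"
  | k where "epoch_bound p k < real t" "real t \<le> epoch_bound p (Suc k)"
proof (cases "real t \<le> epoch_bound p 0")
  case False
  obtain m where "real t / (4 * ln (real p)) < 2 ^ m"
    using real_arch_pow[of 2 "real t / (4 * ln (real p))"] by auto
  then have ex: "real t \<le> epoch_bound p m"
    using assms by (simp add: epoch_bound_def divide_less_eq)
  define k where "k = (LEAST m. real t \<le> epoch_bound p m)"
  have k: "real t \<le> epoch_bound p k" unfolding k_def by (rule LeastI[of _ m]) (rule ex)
  with False obtain j where j: "k = Suc j" by (cases k) auto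
  then have "\<not> real t \<le> epoch_bound p j" using j unfolding k_def by (intro not_less_Least) simp
  with k j show ?thesis using that(2)[of j] by simp
qed (rule that(1))

text \<open>Two distinct epochs containing \<open>t\<close> would make one end no later than the
  other starts, so the \<open>THE\<close> has a single candidate.\<close>

lemma learning_rate_epoch:
  assumes p: "p \<ge> 2" and t: "epoch_bound p k < real t" "real t \<le> epoch_bound p (Suc k)"
  shows "learning_rate p t = sqrt (ln (real p) / epoch_bound p k)"
proof -
  have "(THE k. epoch_bound p k < real t \<and> real t \<le> epoch_bound p (Suc k)) = k"
  proof (rule the_equality)
    fix j assume j: "epoch_bound p j < real t \<and> real t \<le> epoch_bound p (Suc j)"
    have "\<not> Suc j \<le> k" "\<not> Suc k \<le> j"
      using j t epoch_bound_le_iff[OF p, of "Suc j" k] epoch_bound_le_iff[OF p, of "Suc k" j]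
      by linarith+
    then show "j = k" by simp
  qed (use t in simp)
  moreover have "\<not> real t \<le> epoch_bound p 0" using t epoch_bound_le_iff[OF p, of 0 k] by simp
  ultimately show ?thesis by (simp add: learning_rate_def)
qed

lemma learning_rate_initial:
  assumes "p \<ge> 2" "real t \<le> epoch_bound p 0"
  shows "learning_rate p t = 1 / 2"
  using assms by (simp add: learning_rate_def epoch_bound_def real_sqrt_divide)

lemma learning_rate_pos: "p \<ge> 2 \<Longrightarrow> 0 < learning_rate p t"
  by (auto simp: learning_rate_def epoch_bound_pos)

lemma learning_rate_le_half:
  assumes p: "p \<ge> 2"
  shows "learning_rate p t \<le> 1 / 2"
proof (cases rule: epoch_cases[OF p, of t])
  case (2 k)
  have "sqrt (ln (real p) / epoch_bound p k) \<le> sqrt (ln (real p) / epoch_bound p 0)"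
    using p epoch_bound_pos[OF p] epoch_bound_le_iff[OF p, of 0 k]
    by (simp add: frac_le)
  also have "\<dots> = 1 / 2" using p by (simp add: epoch_bound_def real_sqrt_divide)
  finally show ?thesis using learning_rate_epoch[OF p 2] by simp
qed (simp add: learning_rate_initial[OF p])

lemma learning_rate_antimono:
  assumes p: "p \<ge> 2" and "t \<le> u"
  shows "learning_rate p u \<le> learning_rate p t"
proof (cases rule: epoch_cases[OF p, of t])
  case 1
  then show ?thesis using learning_rate_initial[OF p 1] learning_rate_le_half[OF p, of u] by linarith
next
  case (2 j)
  show ?thesis
  proof (cases rule: epoch_cases[OF p, of u])
    case 1
    then show ?thesis using 2 assms epoch_bound_le_iff[OF p, of 0 j] by simp
  next
    case k: (2 k)
    have "\<not> Suc k \<le> j"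
      using 2(1) k(2) assms(2) epoch_bound_le_iff[OF p, of "Suc k" j] by linarith
    then have "epoch_bound p j \<le> epoch_bound p k" using epoch_bound_le_iff[OF p] by simp
    then show ?thesis
      using learning_rate_epoch[OF p 2] learning_rate_epoch[OF p k] p epoch_bound_pos[OF p]
      by (simp add: frac_le)
  qed
qed

text \<open>Rates only decrease after the start of epoch \<open>k\<close>. For \<open>k = 0\<close>
  all times are allowed, because the initial rate 1/2 is also the rate of epoch 0.\<close>

lemma learning_rate_sq_le:
  assumes p: "p \<ge> 2" and t: "k = 0 \<or> epoch_bound p k < real t"
  shows "(learning_rate p t)\<^sup>2 \<le> ln (real p) / epoch_bound p k"
proof (cases rule: epoch_cases[OF p, of t])
  case 1
  then have "k = 0" using t epoch_bound_le_iff[OF p, of 0 k] by auto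
  then show ?thesis using p
    by (simp add: learning_rate_initial[OF p 1] epoch_bound_def power_divide)
next
  case (2 j)
  have "k = 0 \<or> \<not> Suc j \<le> k"
    using 2(2) t epoch_bound_le_iff[OF p, of "Suc j" k] by linarith
  then have "epoch_bound p k \<le> epoch_bound p j" using epoch_bound_le_iff[OF p] by auto
  then show ?thesis
    using learning_rate_epoch[OF p 2] p epoch_bound_pos[OF p] less_imp_le[OF epoch_bound_pos[OF p, of j]]
    by (simp add: frac_le)
qed

text \<open>
  As functions of \<open>T\<close>, the bounds for the various \<open>k\<close> are the linear pieces of the integral of the
  squared rate, which is concave. So the bound holds for every \<open>k\<close>, not just for the epoch of \<open>T\<close>.
\<close>

lemma sum_learning_rate_sq_le:
  assumes p: "p \<ge> 2"
  shows "(\<Sum>t=1..T. (learning_rate p t)\<^sup>2) \<le> ln (real p) * (real k + real T / epoch_bound p k)"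
proof (induction T arbitrary: k)
  case 0
  then show ?case using p by simp
next
  case (Suc T)
  show ?case
  proof (induction k)
    case 0
    then show ?case using Suc[of 0] learning_rate_sq_le[OF p, of 0 "Suc T"]
      by (simp add: add_divide_distrib distrib_left)
  next
    case (Suc k)
    show ?case
    \<comment> \<open>Past the start of epoch \<open>Suc k\<close>, the outer hypothesis is extended
      by one term of the right size. Before it, the inner hypothesis for \<open>k\<close> is already
      the stronger bound.\<close>
    proof (cases "epoch_bound p (Suc k) < real (Suc T)")
      case True
      then show ?thesis
        using \<open>\<And>k. _ \<le> ln (real p) * (real k + real T / epoch_bound p k)\<close>[of "Suc k"]
          learning_rate_sq_le[OF p, of "Suc k" "Suc T"]
        by (simp add: add_divide_distrib distrib_left)
    next
      case False
      then have "real (Suc T) / epoch_bound p (Suc k) \<le> 1"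
        using epoch_bound_pos[OF p, of "Suc k"] by simp
      \<comment> \<open>Doubling the denominator lowers the quotient by
        \<open>real (Suc T) / epoch_bound p (Suc k)\<close>, which is at most the 1 gained in the
        first summand.\<close>
      then have "real k + real (Suc T) / epoch_bound p k
          \<le> real (Suc k) + real (Suc T) / epoch_bound p (Suc k)"
        by (simp add: epoch_bound_Suc)
      then show ?thesis
        using Suc p by (meson mult_left_mono order_trans ln_ge_zero real_of_nat_ge_one_iff one_le_numeral)
    qed
  qed
qed

section \<open>Arrays and schedulers\<close>

text \<open>Reflecting the strict lower triangle onto the upper one turns a bilinear form over all
  ordered pairs into a sum over array entries. This is the source of the two-term shape of
  \<open>q\<close> off the diagonal.\<close>

lemma sum_array_index:
  fixes f :: "'n::{finite,linorder} \<Rightarrow> 'n \<Rightarrow> real"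
  shows "(\<Sum>i\<in>UNIV. \<Sum>j\<in>UNIV. f i j)
     = (\<Sum>(i, j)\<in>array_index. if i = j then f i j else f i j + f j i)"
proof -
  let ?D = "{(i, j). i = j} :: ('n \<times> 'n) set" and ?U = "{(i, j). i < j} :: ('n \<times> 'n) set"
    and ?L = "{(i, j). j < i} :: ('n \<times> 'n) set"
  have "(\<Sum>i\<in>UNIV. \<Sum>j\<in>UNIV. f i j) = (\<Sum>(i, j)\<in>?D \<union> ?U \<union> ?L. f i j)"
    by (subst sum.cartesian_product, rule sum.cong) auto
  also have "\<dots> = (\<Sum>(i, j)\<in>?D. f i j) + (\<Sum>(i, j)\<in>?U. f i j) + (\<Sum>(i, j)\<in>?L. f i j)"
    by (subst sum.union_disjoint; (subst sum.union_disjoint)?) auto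
  also have "(\<Sum>(i, j)\<in>?L. f i j) = (\<Sum>(i, j)\<in>?U. f j i)"
    by (rule sum.reindex_bij_witness[of _ prod.swap prod.swap]) auto
  also have "(\<Sum>(i, j)\<in>?D. f i j) + (\<Sum>(i, j)\<in>?U. f i j) + (\<Sum>(i, j)\<in>?U. f j i)
      = (\<Sum>(i, j)\<in>?D. f i j) + (\<Sum>(i, j)\<in>?U. f i j + f j i)"
    unfolding add.assoc sum.distrib[symmetric]
    by (intro arg_cong2[where f = "(+)"] sum.cong) auto
  finally have *: "(\<Sum>i\<in>UNIV. \<Sum>j\<in>UNIV. f i j)
      = (\<Sum>(i, j)\<in>?D. f i j) + (\<Sum>(i, j)\<in>?U. f i j + f j i)" .
  have index: "array_index = ?D \<union> ?U" by (auto simp: array_index_def)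
  have "(\<Sum>(i, j)\<in>array_index. if i = j then f i j else f i j + f j i)
      = (\<Sum>(i, j)\<in>?D. if i = j then f i j else f i j + f j i)
        + (\<Sum>(i, j)\<in>?U. if i = j then f i j else f i j + f j i)"
    unfolding index by (rule sum.union_disjoint[rotated 2]) auto
  also have "\<dots> = (\<Sum>(i, j)\<in>?D. f i j) + (\<Sum>(i, j)\<in>?U. f i j + f j i)"
    by (intro arg_cong2[where f = "(+)"] sum.cong) auto
  finally show ?thesis using * by simp
qed

text \<open>The triangle and its mirror image cover the square and meet in the diagonal, so twice
  the cardinality is the square of \<open>CARD('n)\<close> plus \<open>CARD('n)\<close>.\<close>

lemma card_array_index:
  "card (array_index :: ('n::{finite,linorder} \<times> 'n) set) = CARD('n) * (CARD('n) + 1) div 2"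
proof -
  let ?A = "array_index :: ('n \<times> 'n) set"
  have "card ?A + card ?A = card ?A + card (prod.swap ` ?A)"
    by (simp add: card_image)
  also have "\<dots> = card (?A \<union> prod.swap ` ?A) + card (?A \<inter> prod.swap ` ?A)"
    by (rule card_Un_Int) auto
  also have "?A \<union> prod.swap ` ?A = UNIV"
    using le_cases by (force simp: array_index_def)
  also have "?A \<inter> prod.swap ` ?A = (\<lambda>i. (i, i)) ` UNIV"
    by (force simp: array_index_def)
  also have "card ((\<lambda>i. (i, i)) ` (UNIV :: 'n set)) = CARD('n)"
    by (simp add: card_image inj_on_def)
  finally show ?thesis by (simp add: card_prod)
qed

lemma array_form_diff: "array_form \<beta> (u - v) y = array_form \<beta> u y - array_form \<beta> v y"
  by (simp add: array_form_def q_def sum_subtractf[symmetric] case_prod_beta algebra_simps cong: sum.cong)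
     (intro sum.cong; auto simp: algebra_simps)

lemma array_form_diff_array:
  "array_form \<beta> u y - array_form \<gamma> u y
     = (\<Sum>(i, j)\<in>array_index. sigma i j * (\<beta> i j - \<gamma> i j) * q i j u y)"
  by (simp add: array_form_def sum_subtractf[symmetric] case_prod_beta algebra_simps)

lemma array_form_scale_right: "array_form \<beta> u (k *\<^sub>R y) = k * array_form \<beta> u y"
  by (auto simp: array_form_def q_def sum_distrib_left algebra_simps intro!: sum.cong)

text \<open>Off the diagonal the signs in \<open>sigma\<close> and \<open>expert_array\<close>
  cancel, and symmetry of \<open>B\<close> merges the two mirrored terms. This links the expert's
  objective to the array form of the learner.\<close>

lemma array_form_expert_array:
  fixes B :: "'n::{finite,linorder} rmatrix"
  assumes "transpose B = B"
  shows "array_form (expert_array c B) u y = c * (u \<bullet> (B *v y))"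
proof -
  have sym: "B $ j $ i = B $ i $ j" for i j
    using assms by (metis transpose_def vec_lambda_beta)
  have "u \<bullet> (B *v y) = (\<Sum>i\<in>UNIV. \<Sum>j\<in>UNIV. u $ i * B $ i $ j * y $ j)"
    by (simp add: inner_vec_def matrix_vector_mult_def sum_distrib_left mult_ac)
  also have "c * \<dots> = array_form (expert_array c B) u y"
    unfolding sum_array_index array_form_def sum_distrib_left
    by (intro sum.cong) (auto simp: expert_array_def sigma_def q_def sym algebra_simps)
  finally show ?thesis by simp
qed

lemma positive_definite_diagonal:
  assumes "positive_definite B"
  shows "0 < B $ i $ i"
proof -
  have "0 < axis i 1 \<bullet> (B *v axis i 1)"
    using assms unfolding positive_definite_def by (simp add: axis_eq_0_iff)
  then show ?thesis
    by (simp add: matrix_vector_mul_component inner_axis inner_axis' column_def matrix_vector_mult_basis)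
qed

section \<open>Maximizers with tie-breaking\<close>

lemma finite_linear_order_least:
  assumes "finite A" "A \<noteq> {}" "A \<subseteq> S" "linear_order_on S r"
  shows "\<exists>u\<in>A. \<forall>v\<in>A. (u, v) \<in> r"
  using assms(1-3)
proof (induction rule: finite_ne_induct)
  case (singleton x)
  then show ?case using assms(4) by (auto simp: order_on_defs refl_on_def)
next
  case (insert x F)
  then obtain u where u: "u \<in> F" "\<forall>v\<in>F. (u, v) \<in> r" by auto
  have r: "trans r" "total_on S r" "refl_on S r" using assms(4) by (auto simp: order_on_defs)
  have "(x, x) \<in> r" "(x, u) \<in> r \<or> (u, x) \<in> r"
    using r(2,3) u insert by (auto simp: refl_on_def total_on_def)
  then show ?case
  proof (elim disjE)
    assume "(x, u) \<in> r"
    then have "\<forall>v\<in>insert x F. (x, v) \<in> r" using u \<open>(x, x) \<in> r\<close> r(1) by (auto dest: transD)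
    then show ?thesis by blast
  qed (use u in auto)
qed

text \<open>The maximizers form a finite nonempty subset of \<open>S\<close>, so an
  \<open>r\<close>-least one exists. Antisymmetry of \<open>r\<close> makes it unique, which
  resolves the \<open>THE\<close>.\<close>

lemma is_arg_max_first_argmax:
  assumes "finite S" "S \<noteq> {}" "linear_order_on S r"
  shows "is_arg_max f (\<lambda>v. v \<in> S) (first_argmax S r f)"
proof -
  let ?M = "{u. is_arg_max f (\<lambda>v. v \<in> S) u}"
  have "Max (f ` S) \<in> f ` S" using assms by simp
  then obtain u0 where "u0 \<in> S" "f u0 = Max (f ` S)" by auto
  then have ne: "?M \<noteq> {}" using assms by (force simp: is_arg_max_def not_less)
  have sub: "?M \<subseteq> S" by (auto simp: is_arg_max_def)
  have "\<exists>u\<in>?M. \<forall>v\<in>?M. (u, v) \<in> r"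
    using finite_linear_order_least[OF finite_subset[OF sub assms(1)] ne sub assms(3)] .
  then obtain u where u: "u \<in> ?M" "\<forall>v\<in>?M. (u, v) \<in> r" by blast
  have "first_argmax S r f = u"
    unfolding first_argmax_def
  proof (rule the_equality)
    fix v assume "is_arg_max f (\<lambda>v. v \<in> S) v \<and> (\<forall>w. is_arg_max f (\<lambda>v. v \<in> S) w \<longrightarrow> (v, w) \<in> r)"
    then show "v = u" using u assms(3) by (auto simp: order_on_defs dest: antisymD)
  qed (use u in auto)
  then show ?thesis using u by simp
qed

lemma first_argmax_in:
  assumes "finite S" "S \<noteq> {}" "linear_order_on S r"
  shows "first_argmax S r f \<in> S"
  using is_arg_max_first_argmax[OF assms, of f] by (simp add: is_arg_max_def)

lemma first_argmax_max:
  assumes "finite S" "S \<noteq> {}" "linear_order_on S r" "v \<in> S"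
  shows "f v \<le> f (first_argmax S r f)"
  using is_arg_max_first_argmax[OF assms(1-3), of f] assms(4) by (force simp: is_arg_max_def)

section \<open>Size of configuration differences, normalized backlogs and costs\<close>

lemma infnorm_diff_le_config_diameter:
  assumes "finite S" "u \<in> S" "v \<in> S"
  shows "infnorm (vreal u - vreal v) \<le> config_diameter S"
  unfolding config_diameter_def using assms by (intro Max_ge) auto

text \<open>Division by zero yields 0, so the scaled vector also covers the empty backlog.\<close>

lemma normalized_backlog_eq:
  "normalized_backlog x = (1 / l1norm (vreal x)) *\<^sub>R vreal x"
  by (simp add: normalized_backlog_def)

lemma normalized_backlog_nonneg: "0 \<le> normalized_backlog x $ i"
  by (simp add: normalized_backlog_eq vreal_def l1norm_def sum_nonneg)

lemma sum_normalized_backlog_le_1: "(\<Sum>i\<in>UNIV. normalized_backlog x $ i) \<le> 1"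
  by (simp add: normalized_backlog_eq vreal_def l1norm_def flip: sum_divide_distrib)

lemma abs_sigma_q_le_1:
  fixes z y :: "'n::finite rvec"
  assumes z: "\<And>i. \<bar>z $ i\<bar> \<le> 1" and y: "\<And>i. 0 \<le> y $ i" "(\<Sum>i\<in>UNIV. y $ i) \<le> 1"
  shows "\<bar>sigma i j * q i j z y\<bar> \<le> 1"
proof -
  have zy: "\<bar>z $ k * y $ l\<bar> \<le> y $ l" for k l
    using mult_right_mono[OF z y(1), of k l] y(1)[of l] by (simp add: abs_mult)
  \<comment> \<open>The set \<open>{i, j}\<close> collapses when \<open>i = j\<close>, so one
    estimate serves both the diagonal and the off-diagonal form of \<open>q\<close>.\<close>
  have "(\<Sum>k\<in>{i, j}. y $ k) \<le> (\<Sum>k\<in>UNIV. y $ k)"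
    using y(1) by (intro sum_mono2) auto
  then have "(\<Sum>k\<in>{i, j}. y $ k) \<le> 1" using y(2) by simp
  then show ?thesis
    using zy[of i i] zy[of i j] zy[of j i] by (auto simp: sigma_def q_def)
qed

lemma abs_mw_cost_le_1:
  assumes "\<And>i. 0 \<le> y $ i" "(\<Sum>i\<in>UNIV. y $ i) \<le> 1"
  shows "\<bar>mw_cost \<delta> y i j\<bar> \<le> 1"
proof (cases "\<delta> = 0")
  case False
  then have "0 < infnorm \<delta>" by (simp add: infnorm_pos_lt)
  then have "\<bar>((1 / infnorm \<delta>) *\<^sub>R \<delta>) $ k\<bar> \<le> 1" for k
    using component_le_infnorm_cart[of \<delta> k] by (simp add: abs_mult)
  then show ?thesis using abs_sigma_q_le_1[of "(1 / infnorm \<delta>) *\<^sub>R \<delta>" y i j] assms False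
    by (simp add: mw_cost_def)
qed (simp add: mw_cost_def)

text \<open>Undoes the normalization of the cost. For \<open>\<delta> = 0\<close> both sides vanish,
  so losses factor without a case distinction.\<close>

lemma infnorm_mult_mw_cost: "infnorm \<delta> * mw_cost \<delta> y i j = sigma i j * q i j \<delta> y"
  using infnorm_eq_0[of \<delta>] by (auto simp: mw_cost_def q_def field_simps)

section \<open>From weighted regret to the average loss\<close>

theorem theorem2:
  fixes n p T :: nat
    and S :: "'n::{finite,linorder} config set"
    and r :: "'n config rel"
    and B :: "'n rmatrix"
    and c D T0 :: real
    and b :: "'n \<Rightarrow> 'n \<Rightarrow> real"
    and x a s :: "nat \<Rightarrow> 'n config"
    and y :: "nat \<Rightarrow> 'n rvec"
  assumes "n = CARD('n)" and "n \<ge> 2"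
    and "p = n * (n + 1) div 2"
    and "T0 = 4 * ln (real p)"
    and "finite S" and "S \<noteq> {}" and "linear_order_on S r"
    and "D = config_diameter S"
    and "transpose B = B" and "positive_definite B"
    and "\<And>i j. i \<noteq> j \<Longrightarrow> B $ i $ j \<le> 0"
    and "c > 0" and "b = expert_array c B"
    and "(\<Sum>(i, j)\<in>array_index. b i j) = 1"
    and "\<And>t. s t = expert_config S r B (x t)"
    and "\<And>t. x (Suc t) = x t - (\<chi> i. min (s t $ i) (x t $ i)) + a t"
    and "\<And>t. y t = normalized_backlog (x t)"
    and "real T \<ge> T0"
  shows "0 \<le> 1 / real T * (\<Sum>t = 1..T. mw_loss S r p b y s t) \<and>
         1 / real T * (\<Sum>t = 1..T. mw_loss S r p b y s t)
           \<le> 2 * sqrt 2 * D * real_of_int \<lceil>log 2 (2 * real T / T0)\<rceil> * sqrt (ln (real p) / real T)"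
proof -
  let ?I = "array_index :: ('n \<times> 'n) set"
  have "n * (n + 1) \<ge> 2 * 3" using \<open>n \<ge> 2\<close> by (intro mult_le_mono) auto
  then have p: "p \<ge> 2" using assms(3) by simp
  then have lnp: "0 < ln (real p)" by simp
  have T0: "T0 = epoch_bound p 0" using assms(4) by (simp add: epoch_bound_def)
  have Tpos: "0 < real T" using assms(18) epoch_bound_pos[OF p, of 0] T0 by linarith
  note S = \<open>finite S\<close> \<open>S \<noteq> {}\<close> \<open>linear_order_on S r\<close>
  define w where "w = mw_weights S r p y s"
  define \<eta> where "\<eta> = learning_rate p"
  define shat where "shat t = scheduler S r (mw_estimate S r p y s t) (y t)" for t
  define \<delta> where "\<delta> t = vreal (shat t) - vreal (s t)" for t
  define m where "m t = mw_cost (\<delta> t) (y t)" for t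
  \<comment> \<open>\<open>L t\<close> is the loss rescaled to costs in \<open>[-1, 1]\<close>, the
    quantity that the regret bound controls.\<close>
  define L where "L t = (\<Sum>(i, j)\<in>?I. (normalize_array (w t) i j - b i j) * m t i j)" for t
  have loss: "mw_loss S r p b y s t
      = array_form (mw_estimate S r p y s t) (\<delta> t) (y t) - array_form b (\<delta> t) (y t)" for t
    unfolding mw_loss_def array_form_diff_array Let_def \<delta>_def shat_def ..
  have s_in: "s t \<in> S" for t using first_argmax_in[OF S] assms(15) by (simp add: expert_config_def)
  have shat_in: "shat t \<in> S" for t using first_argmax_in[OF S] by (simp add: shat_def scheduler_def)
  \<comment> \<open>The form at the normalized backlog is a nonnegative multiple of the objective
    that the expert maximizes at \<open>x t\<close>, so optimality transfers. For an empty backlog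
    the factor is 0.\<close>
  have form_b: "array_form b u (y t) = c / l1norm (vreal (x t)) * (u \<bullet> (B *v vreal (x t)))" for u t
    using assms(9,13,17)
    by (simp add: normalized_backlog_eq array_form_scale_right array_form_expert_array)
  have expert: "array_form b (vreal (shat t)) (y t) \<le> array_form b (vreal (s t)) (y t)" for t
  proof -
    have "0 \<le> c / l1norm (vreal (x t))" using \<open>c > 0\<close> by (simp add: l1norm_def sum_nonneg)
    then show ?thesis unfolding form_b
      using first_argmax_max[OF S shat_in, of "\<lambda>u. vreal u \<bullet> (B *v vreal (x t))" t] assms(15)
      by (intro mult_left_mono) (simp_all add: expert_config_def)
  qed
  have learner: "array_form (mw_estimate S r p y s t) (vreal (s t)) (y t)
      \<le> array_form (mw_estimate S r p y s t) (vreal (shat t)) (y t)" for t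
    using first_argmax_max[OF S s_in] by (simp add: shat_def scheduler_def)
  \<comment> \<open>The loss is the learner's advantage of \<open>shat t\<close> over
    \<open>s t\<close> under the estimate, plus the expert's advantage of \<open>s t\<close> over
    \<open>shat t\<close> under \<open>b\<close>.\<close>
  have loss_nonneg: "0 \<le> mw_loss S r p b y s t" for t
    unfolding loss \<delta>_def array_form_diff using expert[of t] learner[of t] by simp
  have loss_L: "mw_loss S r p b y s t = infnorm (\<delta> t) * L t" for t
    unfolding loss array_form_diff_array L_def m_def sum_distrib_left
    by (intro sum.cong) (auto simp: mw_estimate_def w_def infnorm_mult_mw_cost[symmetric])
  have L_nonneg: "0 \<le> L t" for t
  proof (cases "\<delta> t = 0")
    case True
    then show ?thesis by (simp add: L_def m_def mw_cost_def)
  next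
    case False
    then show ?thesis using loss_nonneg[of t] infnorm_pos_lt[of "\<delta> t"]
      unfolding loss_L by (simp add: zero_le_mult_iff)
  qed
  have D: "infnorm (\<delta> t) \<le> D" for t
    using infnorm_diff_le_config_diameter[OF S(1) shat_in s_in] assms(8) by (simp add: \<delta>_def)
  then have D_nonneg: "0 \<le> D" using infnorm_pos_le order_trans by blast
  have b_nonneg: "0 \<le> b i j" for i j
    using \<open>c > 0\<close> assms(11)[of i j] positive_definite_diagonal[OF assms(10), of i] assms(13)
    by (auto simp: expert_array_def mult_nonneg_nonpos)
  have y: "0 \<le> y t $ i" "(\<Sum>i\<in>UNIV. y t $ i) \<le> 1" for t i
    using assms(17) normalized_backlog_nonneg sum_normalized_backlog_le_1 by auto
  have regret: "(\<Sum>t=1..T. \<eta> t * L t) \<le> ln (real p) + (\<Sum>t=1..T. (\<eta> t)\<^sup>2)"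
  proof -
    \<comment> \<open>Each index pair is one action, and \<open>b\<close> is the comparison
      distribution: it is nonnegative and sums to 1.\<close>
    have "(\<Sum>t=1..T. \<eta> t * (\<Sum>e\<in>?I. (case_prod (w t) e / sum (case_prod (w t)) ?I
              - case_prod b e) * case_prod (m t) e))
        \<le> ln (real (card ?I)) + (\<Sum>t=1..T. (\<eta> t)\<^sup>2)"
    proof (rule multiplicative_weights_regret)
      fix t :: nat and e :: "'n \<times> 'n" assume "t \<ge> 1"
      then show "case_prod (w (Suc t)) e = case_prod (w t) e * (1 - \<eta> t * case_prod (m t) e)"
        by (simp add: w_def \<eta>_def m_def \<delta>_def shat_def mw_estimate_def Let_def case_prod_beta)
    qed (use assms(14) b_nonneg y learning_rate_le_half[OF p] less_imp_le[OF learning_rate_pos[OF p]]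
        in \<open>auto simp: w_def m_def \<eta>_def intro!: abs_mw_cost_le_1\<close>)
    moreover have "card ?I = p" using card_array_index assms(1,3) by simp
    moreover have "(\<Sum>e\<in>?I. (case_prod (w t) e / sum (case_prod (w t)) ?I
        - case_prod b e) * case_prod (m t) e) = L t" for t
      unfolding L_def by (intro sum.cong) (auto simp: normalize_array_def)
    ultimately show ?thesis by simp
  qed
  have total: "\<eta> T * (\<Sum>t=1..T. L t) \<le> ln (real p) * (1 + real k + real T / epoch_bound p k)" for k
  proof -
    have "\<eta> T * (\<Sum>t=1..T. L t) \<le> (\<Sum>t=1..T. \<eta> t * L t)"
      unfolding sum_distrib_left \<eta>_def
      by (intro sum_mono mult_right_mono learning_rate_antimono[OF p] L_nonneg) auto
    then show ?thesis
      using regret sum_learning_rate_sq_le[OF p, of T k] by (simp add: \<eta>_def algebra_simps)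
  qed
  have sqrt2: "7 / 5 \<le> sqrt (2 :: real)" by (rule real_le_rsqrt) (simp add: power2_eq_square)
  have main: "(\<Sum>t=1..T. L t)
      \<le> 2 * sqrt 2 * real_of_int \<lceil>log 2 (2 * real T / T0)\<rceil> * sqrt (ln (real p) * real T)"
  proof (cases rule: epoch_cases[OF p, of T])
    \<comment> \<open>With \<open>T0 \<le> T\<close> this case forces \<open>T = T0\<close>. The
      logarithm is then 1, and \<open>total\<close> at \<open>k = 0\<close> gives
      \<open>4 * ln p\<close>.\<close>
    case 1
    then have T: "real T = 4 * ln (real p)" using assms(18) T0 by (simp add: epoch_bound_def)
    have "sqrt (ln (real p) * real T) = sqrt ((2 * ln (real p))\<^sup>2)"
      unfolding T by (simp add: power2_eq_square)
    then have "sqrt (ln (real p) * real T) = 2 * ln (real p)"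
      unfolding real_sqrt_abs using lnp by simp
    moreover have "log 2 (2 * real T / T0) = 1" using T assms(4) lnp by simp
    moreover have "(\<Sum>t=1..T. L t) \<le> 4 * ln (real p)"
      using total[of 0] learning_rate_initial[OF p 1] T lnp by (simp add: \<eta>_def epoch_bound_def)
    moreover have "4 * ln (real p) \<le> 4 * sqrt 2 * ln (real p)" using sqrt2 lnp by simp
    ultimately show ?thesis by simp
  next
    case (2 k)
    let ?E = "epoch_bound p k"
    have E: "0 < ?E" by (rule epoch_bound_pos[OF p])
    have E': "?E = 2 ^ k * T0" using T0 by (simp add: epoch_bound_def)
    have T0pos: "0 < T0" using T0 epoch_bound_pos[OF p] by simp
    \<comment> \<open>Within epoch \<open>k\<close>, \<open>2 * T / T0\<close> lies above
      \<open>2 ^ (k + 1)\<close> and is at most \<open>2 ^ (k + 2)\<close>. The half-open epochs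
      match the rounding of the ceiling.\<close>
    have ceil: "\<lceil>log 2 (2 * real T / T0)\<rceil> = int k + 2"
    proof (rule ceiling_unique)
      have "2 powr real (k + 1) < 2 * real T / T0"
        using 2(1) T0pos unfolding E' by (simp add: powr_realpow powr_add less_divide_eq)
      then show "real_of_int (int k + 2) - 1 < log 2 (2 * real T / T0)"
        using Tpos T0pos by (simp add: less_log_iff add.commute)
      have "2 * real T / T0 \<le> 2 powr real (k + 2)"
        using 2(2) T0pos unfolding epoch_bound_Suc E'
        by (simp add: powr_realpow powr_add divide_le_eq mult_ac)
      then show "log 2 (2 * real T / T0) \<le> real_of_int (int k + 2)"
        using Tpos T0pos by (simp add: log_le_iff add.commute)
    qed
    \<comment> \<open>Writing \<open>ln p\<close> as a multiple of the current rate allows this rate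
      to be cancelled from both sides of \<open>total\<close>.\<close>
    have eta: "\<eta> T * sqrt (ln (real p) * ?E) = ln (real p)"
      unfolding \<eta>_def learning_rate_epoch[OF p 2] real_sqrt_mult[symmetric] using E lnp by simp
    have "real T / ?E \<le> 2" using 2(2) E by (simp add: epoch_bound_Suc divide_le_eq)
    then have "ln (real p) * (1 + real k + real T / ?E) \<le> ln (real p) * (real k + 3)"
      using lnp by simp
    also have "\<dots> = \<eta> T * ((real k + 3) * sqrt (ln (real p) * ?E))"
      unfolding mult.left_commute[of "\<eta> T"] eta by (rule mult.commute)
    finally have "\<eta> T * (\<Sum>t=1..T. L t) \<le> \<eta> T * ((real k + 3) * sqrt (ln (real p) * ?E))"
      using total[of k] by (rule order_trans[rotated])
    then have "(\<Sum>t=1..T. L t) \<le> (real k + 3) * sqrt (ln (real p) * ?E)"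
      using learning_rate_pos[OF p, of T] by (simp add: \<eta>_def)
    \<comment> \<open>The epoch start lies below \<open>T\<close>, and the factor
      \<open>2 * sqrt 2\<close> leaves ample room to pass from \<open>k + 3\<close> to
      \<open>k + 2\<close>.\<close>
    also have "\<dots> \<le> (2 * sqrt 2 * (real k + 2)) * sqrt (ln (real p) * real T)"
    proof (intro mult_mono)
      have "2 * (7 / 5) * (real k + 2) \<le> 2 * sqrt 2 * (real k + 2)"
        using sqrt2 by (intro mult_right_mono) auto
      then show "real k + 3 \<le> 2 * sqrt 2 * (real k + 2)" by (simp add: field_simps)
    qed (use 2 lnp E in auto)
    finally show ?thesis unfolding ceil by (simp add: mult_ac add.commute)
  qed
  have "(\<Sum>t=1..T. mw_loss S r p b y s t) \<le> D * (\<Sum>t=1..T. L t)"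
    unfolding loss_L sum_distrib_left by (intro sum_mono mult_right_mono D L_nonneg)
  also have "\<dots> \<le> D * (2 * sqrt 2 * real_of_int \<lceil>log 2 (2 * real T / T0)\<rceil> * sqrt (ln (real p) * real T))"
    by (rule mult_left_mono[OF main D_nonneg])
  also have "sqrt (ln (real p) * real T) = real T * sqrt (ln (real p) / real T)"
    using Tpos by (simp add: real_sqrt_mult real_sqrt_divide field_simps)
  finally have "(\<Sum>t=1..T. mw_loss S r p b y s t) \<le> real T *
      (2 * sqrt 2 * D * real_of_int \<lceil>log 2 (2 * real T / T0)\<rceil> * sqrt (ln (real p) / real T))"
    by (simp add: mult_ac)
  then have "1 / real T * (\<Sum>t=1..T. mw_loss S r p b y s t)
      \<le> 2 * sqrt 2 * D * real_of_int \<lceil>log 2 (2 * real T / T0)\<rceil> * sqrt (ln (real p) / real T)"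
    using Tpos by (simp add: divide_le_eq mult_ac)
  then show ?thesis using loss_nonneg by (simp add: sum_nonneg)
qed

end
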